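(* Let $G_1$ and $G_2$ be simple graphs with cordial labelings $f:V(G_1)\to\{0,1\}$ and $g:V(G_2)\to\{0,1\}$ respectively, and suppose $G_1$ is connected, bipartite, and has an even number of edges. Then the induced labeling $h:V(G_1\times G_2)\to\{0,1\}$, $h(u,v)=f(u)+g(v)\pmod 2$, is a cordial labeling of the tensor product $G_1\times G_2$.
   Context: A binary labeling of a graph $G$ is a map $f:V(G)\to\{0,1\}$, inducing an edge labeling $f_e(uv)=f(u)+f(v)\pmod 2$. Two real numbers $x,y$ are roughly equal if $|x-y|\le 1$. A binary labeling $f$ is friendly if $|f^{-1}(0)|$ and $|f^{-1}(1)|$ are roughly equal, and cordial if it is friendly and $|f_e^{-1}(0)|$ and $|f_e^{-1}(1)|$ are roughly equal. The tensor product $G_1\times G_2$ has vertex set $V(G_1)\times V(G_2)$, with $(u_1,u_2)$ adjacent to $(v_1,v_2)$ if and only if $u_1v_1\in E(G_1)$ and $u_2v_2\in E(G_2)$. *)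

theory Defs
  imports Complex_Main "Graph_Theory.Graph_Theory"
begin

text \<open>
  A finite simple graph is a \<open>pair_graph\<close>, i.e. a finite loop-free digraph without parallel arcs
  whose arc relation is symmetric. Each undirected edge thus appears as two opposite arcs, so
  edges have to be counted as unordered pairs.
\<close>

definition edges :: "'a pair_pre_digraph \<Rightarrow> 'a set set" where
  "edges G = {{u, v} | u v. (u, v) \<in> parcs G}"

definition bipartite :: "'a pair_pre_digraph \<Rightarrow> bool" where
  "bipartite G \<longleftrightarrow> (\<exists>A B. pverts G = A \<union> B \<and> A \<inter> B = {} \<and>
     (\<forall>(u, v) \<in> parcs G. (u \<in> A \<and> v \<in> B) \<or> (u \<in> B \<and> v \<in> A)))"

definition tensor_product ::
    "'a pair_pre_digraph \<Rightarrow> 'b pair_pre_digraph \<Rightarrow> ('a \<times> 'b) pair_pre_digraph" where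
  "tensor_product G H = \<lparr> pverts = pverts G \<times> pverts H,
     parcs = {((u1, u2), (v1, v2)) | u1 u2 v1 v2. (u1, v1) \<in> parcs G \<and> (u2, v2) \<in> parcs H} \<rparr>"

definition binary_labeling :: "'a pair_pre_digraph \<Rightarrow> ('a \<Rightarrow> nat) \<Rightarrow> bool" where
  "binary_labeling G f \<longleftrightarrow> (\<forall>v \<in> pverts G. f v \<in> {0, 1})"

text \<open>For \<open>u \<noteq> v\<close>, the sum over \<open>{u, v}\<close> is \<open>f u + f v\<close>; see \<open>edge_label_pair\<close> below.\<close>

definition edge_label :: "('a \<Rightarrow> nat) \<Rightarrow> 'a set \<Rightarrow> nat" where
  "edge_label f e = (\<Sum>v\<in>e. f v) mod 2"

definition roughly_equal :: "real \<Rightarrow> real \<Rightarrow> bool" where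
  "roughly_equal x y \<longleftrightarrow> \<bar>x - y\<bar> \<le> 1"

definition friendly :: "'a pair_pre_digraph \<Rightarrow> ('a \<Rightarrow> nat) \<Rightarrow> bool" where
  "friendly G f \<longleftrightarrow> binary_labeling G f \<and>
     roughly_equal (real (card {v \<in> pverts G. f v = 0})) (real (card {v \<in> pverts G. f v = 1}))"

definition cordial :: "'a pair_pre_digraph \<Rightarrow> ('a \<Rightarrow> nat) \<Rightarrow> bool" where
  "cordial G f \<longleftrightarrow> friendly G f \<and>
     roughly_equal (real (card {e \<in> edges G. edge_label f e = 0}))
       (real (card {e \<in> edges G. edge_label f e = 1}))"

lemma edge_label_pair: "u \<noteq> v \<Longrightarrow> edge_label f {u, v} = (f u + f v) mod 2"
  by (simp add: edge_label_def)

lemma pair_graph_tensor_product: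
  assumes "pair_graph G" "pair_graph H"
  shows "pair_graph (tensor_product G H)"
proof -
  interpret G: pair_graph G by fact
  interpret H: pair_graph H by fact
  have "parcs (tensor_product G H) \<subseteq> (pverts G \<times> pverts H) \<times> (pverts G \<times> pverts H)"
    by (auto simp: tensor_product_def dest: G.wellformed' H.wellformed')
  then have "finite (parcs (tensor_product G H))"
    by (rule finite_subset) (simp add: G.pair_finite_verts H.pair_finite_verts)
  moreover have "sym (parcs G)" "sym (parcs H)"
    using G.pair_sym_arcs H.pair_sym_arcs by (simp_all add: symmetric_def)
  then have "sym (parcs (tensor_product G H))"
    by (auto simp: tensor_product_def sym_def)
  ultimately show ?thesis
    by unfold_locales
      (auto simp: tensor_product_def symmetric_def G.pair_finite_verts H.pair_finite_verts
        dest: G.wellformed' H.wellformed' G.pair_no_loops H.pair_no_loops)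
qed

end

theory Submission
  imports Defs
begin

text \<open>
  Give label \<open>k\<close> the sign \<open>(-1) ^ k\<close>. Being cordial means that the signs of the vertices, and those
  of the edges, have sums of absolute value at most \<open>1\<close>. The sign sum over the vertices of the
  tensor product is the product of the two vertex sums. The same holds for the sums over arcs, which
  are twice the sums over edges. An even number of edges forces the edge sum of \<open>G1\<close> to be even,
  hence \<open>0\<close>, so the edge sum of the tensor product is \<open>0\<close> as well.
\<close>

lemma edges_conv_image: "edges G = (\<lambda>(u, v). {u, v}) ` parcs G"
  by (auto simp: edges_def image_iff)

text \<open>This describes the fibre over an edge of the map that forgets the direction of an
  arc.\<close>

lemma doubleton_fibre:
  assumes "(u, v) \<in> R" and "(v, u) \<in> R"
  shows "{a \<in> R. (\<lambda>(x, y). {x, y}) a = {u, v}} = {(u, v), (v, u)}"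
proof (rule set_eqI)
  fix a
  show "a \<in> {a \<in> R. (\<lambda>(x, y). {x, y}) a = {u, v}} \<longleftrightarrow> a \<in> {(u, v), (v, u)}"
    using assms by (cases a) (simp add: doubleton_eq_iff, blast)
qed

lemma minus_one_power_mod_two: "(-1 :: 'a::ring_1) ^ (n mod 2) = (-1) ^ n"
  by (cases "even n") (auto simp: odd_iff_mod_2_eq_one)

text \<open>Label 0 contributes 1 and label 1 contributes -1. This trades a difference of
  cardinalities for a sign sum, which is multiplicative under addition of labels.\<close>

lemma card_label_diff:
  assumes "finite A" and "\<And>x. x \<in> A \<Longrightarrow> l x \<in> {0, 1 :: nat}"
  shows "int (card {x \<in> A. l x = 0}) - int (card {x \<in> A. l x = 1}) = (\<Sum>x\<in>A. (-1) ^ l x)"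
proof -
  have "(\<Sum>x\<in>A. (-1 :: int) ^ l x) = (\<Sum>x\<in>A. of_bool (l x = 0) - of_bool (l x = 1))"
    using assms(2) by (intro sum.cong) fastforce+
  then show ?thesis
    using assms(1) by (simp add: sum_subtractf Int_def)
qed

lemma card_label_add:
  assumes "finite A" and "\<And>x. x \<in> A \<Longrightarrow> l x \<in> {0, 1 :: nat}"
  shows "card {x \<in> A. l x = 0} + card {x \<in> A. l x = 1} = card A"
proof -
  have "A = {x \<in> A. l x = 0} \<union> {x \<in> A. l x = 1}"
    using assms(2) by auto
  moreover have "{x \<in> A. l x = 0} \<inter> {x \<in> A. l x = 1} = {}"
    by auto
  ultimately show ?thesis
    using assms(1) by (metis (no_types, lifting) card_Un_disjoint finite_Un)
qed

lemma roughly_equal_of_nat: "roughly_equal (real m) (real n) \<longleftrightarrow> \<bar>int m - int n\<bar> \<le> 1"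
  unfolding roughly_equal_def by linarith

lemma edge_label_range: "edge_label f e \<in> {0, 1}"
  by (auto simp: edge_label_def)

context pair_graph
begin

lemma finite_edges: "finite (edges G)"
  by (simp add: edges_conv_image)

text \<open>Grouping the arcs by their underlying edge gives two equal terms per edge. Arcs are
  preferred because those of a tensor product correspond to pairs of arcs, whereas a pair of edges
  yields two edges of the product.\<close>

lemma sum_arcs_conv_sum_edges:
  "(\<Sum>(u, v)\<in>parcs G. F {u, v}) = (2 :: int) * (\<Sum>e\<in>edges G. F e)"
proof -
  have fibre: "(\<Sum>a | a \<in> parcs G \<and> (\<lambda>(u, v). {u, v}) a = e. case a of (u, v) \<Rightarrow> F {u, v}) = 2 * F e"
    if "e \<in> edges G" for e
  proof -
    from that obtain u v where uv: "(u, v) \<in> parcs G" "e = {u, v}"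
      by (auto simp: edges_def)
    \<comment> \<open>Since there are no loops, the two opposite arcs are distinct and the fibre has
      two terms, not one.\<close>
    then have "u \<noteq> v"
      using pair_no_loops[of "(u, v)"] by simp
    have "(v, u) \<in> parcs G"
      using uv pair_sym_arcs by (simp add: symmetric_def symD)
    with uv have "{a \<in> parcs G. (\<lambda>(u, v). {u, v}) a = e} = {(u, v), (v, u)}"
      by (simp only: doubleton_fibre)
    with uv \<open>u \<noteq> v\<close> show ?thesis
      by (simp add: insert_commute[of v u])
  qed
  have "(\<Sum>(u, v)\<in>parcs G. F {u, v}) =
      (\<Sum>e\<in>edges G. \<Sum>a | a \<in> parcs G \<and> (\<lambda>(u, v). {u, v}) a = e. case a of (u, v) \<Rightarrow> F {u, v})"
    unfolding edges_conv_image by (rule sum.image_gen) simp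
  also have "\<dots> = (\<Sum>e\<in>edges G. 2 * F e)"
    using fibre by (rule sum.cong[OF refl])
  finally show ?thesis
    by (simp add: sum_distrib_left)
qed

lemma sum_arc_signs:
  "(\<Sum>(u, v)\<in>parcs G. (-1 :: int) ^ (f u + f v)) = 2 * (\<Sum>e\<in>edges G. (-1) ^ edge_label f e)"
proof -
  have "(-1 :: int) ^ (f u + f v) = (-1) ^ edge_label f {u, v}" if "(u, v) \<in> parcs G" for u v
    using that pair_no_loops by (auto simp: edge_label_pair minus_one_power_mod_two)
  then have "(\<Sum>(u, v)\<in>parcs G. (-1 :: int) ^ (f u + f v)) =
      (\<Sum>(u, v)\<in>parcs G. (-1) ^ edge_label f {u, v})"
    by (intro sum.cong) auto
  then show ?thesis
    by (simp add: sum_arcs_conv_sum_edges[of "\<lambda>e. (-1) ^ edge_label f e"])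
qed

lemma friendly_iff_sum:
  "friendly G f \<longleftrightarrow> binary_labeling G f \<and> \<bar>\<Sum>v\<in>pverts G. (-1 :: int) ^ f v\<bar> \<le> 1"
  using card_label_diff[OF pair_finite_verts, of f]
  by (auto simp: friendly_def binary_labeling_def roughly_equal_of_nat)

lemma cordial_iff_sum:
  "cordial G f \<longleftrightarrow> friendly G f \<and> \<bar>\<Sum>e\<in>edges G. (-1 :: int) ^ edge_label f e\<bar> \<le> 1"
  using card_label_diff[of "edges G" "edge_label f", OF finite_edges edge_label_range]
  by (simp add: cordial_def roughly_equal_of_nat)

text \<open>The sign sum is the difference of the two label counts, which has the parity of their
  sum, the number of edges.\<close>

lemma even_sum_edge_signs:
  assumes "even (card (edges G))"
  shows "even (\<Sum>e\<in>edges G. (-1 :: int) ^ edge_label f e)"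
  using assms card_label_add[of "edges G" "edge_label f", OF finite_edges edge_label_range]
  unfolding card_label_diff[of "edges G" "edge_label f", OF finite_edges edge_label_range, symmetric]
  by (simp only: even_diff even_of_nat flip: of_nat_add)

end

theorem theorem6:
  fixes G1 :: "'a pair_pre_digraph" and G2 :: "'b pair_pre_digraph"
    and f :: "'a \<Rightarrow> nat" and g :: "'b \<Rightarrow> nat" and h :: "'a \<times> 'b \<Rightarrow> nat"
  assumes "pair_graph G1" and "pair_graph G2"
    and "cordial G1 f" and "cordial G2 g"
    and "Digraph_Component.connected (with_proj G1)"
    and "bipartite G1"
    and "even (card (edges G1))"
    and "\<And>u v. u \<in> pverts G1 \<Longrightarrow> v \<in> pverts G2 \<Longrightarrow> h (u, v) = (f u + g v) mod 2"
  shows "cordial (tensor_product G1 G2) h"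
proof -
  interpret G1: pair_graph G1 by fact
  interpret G2: pair_graph G2 by fact
  let ?T = "tensor_product G1 G2"
  interpret T: pair_graph ?T
    using assms(1,2) by (rule pair_graph_tensor_product)
  have h_sign: "(-1 :: int) ^ h (u, v) = (-1) ^ f u * (-1) ^ g v"
    if "u \<in> pverts G1" "v \<in> pverts G2" for u v
    using that by (simp add: assms(8) minus_one_power_mod_two power_add)
  have verts: "(\<Sum>x\<in>pverts ?T. (-1 :: int) ^ h x) =
      (\<Sum>u\<in>pverts G1. (-1) ^ f u) * (\<Sum>v\<in>pverts G2. (-1) ^ g v)"
    unfolding sum_product sum.cartesian_product
    by (rule sum.cong) (auto simp: tensor_product_def h_sign)
  \<comment> \<open>Both factors have absolute value at most 1, hence so does their product.\<close>
  have "\<bar>\<Sum>x\<in>pverts ?T. (-1 :: int) ^ h x\<bar> \<le> 1"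
    using assms(3,4) mult_mono[of _ "1 :: int" _ 1] unfolding verts abs_mult
    by (simp add: G1.cordial_iff_sum G1.friendly_iff_sum G2.cordial_iff_sum G2.friendly_iff_sum)
  moreover have "binary_labeling ?T h"
    by (auto simp: binary_labeling_def tensor_product_def assms(8))
  ultimately have friendly: "friendly ?T h"
    by (simp add: T.friendly_iff_sum)
  obtain k where "(\<Sum>e\<in>edges G1. (-1 :: int) ^ edge_label f e) = 2 * k"
    using G1.even_sum_edge_signs[OF assms(7)] by (rule evenE)
  \<comment> \<open>Cordiality of \<open>f\<close> bounds \<open>2 * k\<close> by 1 in absolute
    value, and the only such even integer is 0.\<close>
  then have "(\<Sum>e\<in>edges G1. (-1 :: int) ^ edge_label f e) = 0"
    using assms(3) by (auto simp: G1.cordial_iff_sum)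
  then have arcs_G1: "(\<Sum>(u, v)\<in>parcs G1. (-1 :: int) ^ (f u + f v)) = 0"
    by (simp add: G1.sum_arc_signs)
  have h_arc_sign: "(-1 :: int) ^ (h (u1, u2) + h (v1, v2)) = (-1) ^ (f u1 + f v1) * (-1) ^ (g u2 + g v2)"
    if "(u1, v1) \<in> parcs G1" "(u2, v2) \<in> parcs G2" for u1 v1 u2 v2
    using G1.wellformed'[OF that(1)] G2.wellformed'[OF that(2)] by (simp add: power_add h_sign)
  have "(\<Sum>(x, y)\<in>parcs ?T. (-1 :: int) ^ (h x + h y)) =
      (\<Sum>((u1, v1), (u2, v2))\<in>parcs G1 \<times> parcs G2. (-1) ^ (f u1 + f v1) * (-1) ^ (g u2 + g v2))"
    \<comment> \<open>Swapping the two middle coordinates turns an arc of the product into a pair of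
      arcs, one from each factor.\<close>
    by (rule sum.reindex_bij_witness[where
          i = "\<lambda>((u1, v1), (u2, v2)). ((u1, u2), (v1, v2))" and
          j = "\<lambda>((u1, u2), (v1, v2)). ((u1, v1), (u2, v2))"])
      (auto simp: tensor_product_def h_arc_sign)
  also have "\<dots> = (\<Sum>(u, v)\<in>parcs G1. (-1) ^ (f u + f v)) * (\<Sum>(u, v)\<in>parcs G2. (-1) ^ (g u + g v))"
    unfolding sum_product sum.cartesian_product by (rule sum.cong) auto
  also have "\<dots> = 0"
    by (simp add: arcs_G1)
  \<comment> \<open>The vanishing arc sum is twice the edge sum, so the two edge labels occur
    equally often in the product.\<close>
  finally have "(\<Sum>e\<in>edges ?T. (-1 :: int) ^ edge_label h e) = 0"
    by (simp add: T.sum_arc_signs)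
  with friendly show ?thesis
    by (simp add: T.cordial_iff_sum)
qed

end
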